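(* Let $D\ge 1$ and $N>2D$ be integers, let $q$ be a prime power, let $\Gamma=J_q(N,D)$, let $x$ be a vertex of $\Gamma$, and let $0\le i\le D$. Then the graph $\gamma_i(x)$ consists of $\binom{D}{i}_q$ connected components, where each component is the subgraph induced on $G_\alpha$ for some subspace $\alpha\subseteq x$ with $\dim\alpha=D-i$.
   Context: Let $\mathbb{F}_q$ be a finite field with $q$ elements and $\mathcal{V}$ an $N$-dimensional vector space over $\mathbb{F}_q$. The Grassmann graph $\Gamma=J_q(N,D)$ has vertex set $X$ consisting of the $D$-dimensional subspaces of $\mathcal{V}$; $y,z\in X$ are adjacent iff $\dim(y\cap z)=D-1$. Let $\partial$ be the path-length distance; for $N>2D$ the diameter is $D$ and $\partial(y,z)=D-\dim(y\cap z)$. Put $\Gamma_i(x)=\{y\in X:\partial(x,y)=i\}$. For subspaces $u\subseteq v$ of $\mathcal{V}$ with $\dim v=\dim u+1$: $v$ $/$-covers $u$ if $\dim(v\cap x)=\dim(u\cap x)+1$, and $v$ $\backslash$-covers $u$ if $\dim(v\cap x)=\dim(u\cap x)$. If $y,z\in\Gamma_i(x)$ are adjacent, then $y\cap z$ is either $/$-covered by each of $y,z$ or $\backslash$-covered by each of $y,z$. The graph $\gamma_i(x)$ has vertex set $\Gamma_i(x)$ and is obtained from the subgraph of $\Gamma$ induced on $\Gamma_i(x)$ by removing all edges $yz$ for which $y\cap z$ is $/$-covered by each of $y$ and $z$. For a subspace $\alpha\subseteq x$ let $G_\alpha=\{y\in X: y\cap x=\alpha\}$. $[\ell]=\frac{q^\ell-1}{q-1}$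 and $\binom{\ell}{n}_q=\frac{[\ell][\ell-1]\cdots[\ell-n+1]}{[n][n-1]\cdots[1]}$ for $0\le n\le \ell$. *)

theory Defs
  imports "Graph_Theory.Graph_Theory"
begin

text \<open>
  The Gaussian binomial coefficient, with values in the rationals so that the quotients of the
  usual formulas are exact. It is only meaningful for \<open>n \<le> l\<close>, since \<open>l - k\<close> is
  truncated subtraction.
\<close>

definition q_int :: "nat \<Rightarrow> nat \<Rightarrow> rat" where
  "q_int q l = (of_nat q ^ l - 1) / (of_nat q - 1)"

definition q_binomial :: "nat \<Rightarrow> nat \<Rightarrow> nat \<Rightarrow> rat" where
  "q_binomial q l n = (\<Prod>k<n. q_int q (l - k)) / (\<Prod>k<n. q_int q (n - k))"

text \<open>
  Undirected graphs are represented by digraphs in which every edge \<open>yz\<close> occurs as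
  the two arcs \<open>(y, z)\<close> and \<open>(z, y)\<close>.
\<close>

definition components :: "('a, 'b) pre_digraph \<Rightarrow> ('a, 'b) pre_digraph set" where
  "components G = {H. pre_digraph.max_subgraph G Digraph_Component.connected H}"

text \<open>With unit weights, the cost of a walk is its length.\<close>

definition path_length_dist :: "('a, 'b) pre_digraph \<Rightarrow> 'a \<Rightarrow> 'a \<Rightarrow> ereal" where
  "path_length_dist G = wf_digraph.\<mu> G (\<lambda>_. 1)"

definition sphere :: "('a, 'b) pre_digraph \<Rightarrow> 'a \<Rightarrow> nat \<Rightarrow> 'a set" where
  "sphere G x i = {y \<in> verts G. path_length_dist G x y = ereal (real i)}"

definition grassmann_vertices ::
    "('a::field \<Rightarrow> 'b::ab_group_add \<Rightarrow> 'b) \<Rightarrow> nat \<Rightarrow> 'b set set" where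
  "grassmann_vertices scale D = {y. module.subspace scale y \<and> vector_space.dim scale y = D}"

definition grassmann_graph ::
    "('a::field \<Rightarrow> 'b::ab_group_add \<Rightarrow> 'b) \<Rightarrow> nat \<Rightarrow> ('b set, 'b set \<times> 'b set) pre_digraph" where
  "grassmann_graph scale D = with_proj \<lparr>
     pverts = grassmann_vertices scale D,
     parcs = {(y, z). y \<in> grassmann_vertices scale D \<and> z \<in> grassmann_vertices scale D \<and>
                      vector_space.dim scale (y \<inter> z) = D - 1}\<rparr>"

text \<open>Argument order: \<open>v\<close> slash-covers \<open>u\<close>, relative to \<open>x\<close>.\<close>

definition slash_covers ::
    "('a::field \<Rightarrow> 'b::ab_group_add \<Rightarrow> 'b) \<Rightarrow> 'b set \<Rightarrow> 'b set \<Rightarrow> 'b set \<Rightarrow> bool" where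
  "slash_covers scale x v u \<longleftrightarrow>
     module.subspace scale u \<and> module.subspace scale v \<and> u \<subseteq> v \<and>
     vector_space.dim scale v = vector_space.dim scale u + 1 \<and>
     vector_space.dim scale (v \<inter> x) = vector_space.dim scale (u \<inter> x) + 1"

definition gamma_graph ::
    "('a::field \<Rightarrow> 'b::ab_group_add \<Rightarrow> 'b) \<Rightarrow> nat \<Rightarrow> 'b set \<Rightarrow> nat \<Rightarrow>
     ('b set, 'b set \<times> 'b set) pre_digraph" where
  "gamma_graph scale D x i =
     (let H = grassmann_graph scale D \<restriction> sphere (grassmann_graph scale D) x i
      in H \<lparr> arcs := arcs H -
               {(y, z). slash_covers scale x y (y \<inter> z) \<and> slash_covers scale x z (y \<inter> z)} \<rparr>)"

definition G_set ::
    "('a::field \<Rightarrow> 'b::ab_group_add \<Rightarrow> 'b) \<Rightarrow> nat \<Rightarrow> 'b set \<Rightarrow> 'b set \<Rightarrow> 'b set set" where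
  "G_set scale D x \<alpha> = {y \<in> grassmann_vertices scale D. y \<inter> x = \<alpha>}"

lemma sym_digraph_grassmann_graph: "sym_digraph (grassmann_graph scale D)"
  by unfold_locales
    (auto simp: grassmann_graph_def symmetric_def Int_commute intro!: symI)

lemma sym_digraph_gamma_graph: "sym_digraph (gamma_graph scale D x i)"
  by unfold_locales
    (auto simp: gamma_graph_def grassmann_graph_def symmetric_def arcs_ends_conv Let_def
       Int_commute image_iff intro!: symI)

end

theory Submission
  imports Defs
begin

text \<open>
  The map \<open>y \<mapsto> y \<inter> x\<close> is constant along the edges of \<open>\<gamma>\<^sub>i(x)\<close>, because
  an edge whose ends meet \<open>x\<close> in distinct subspaces is slash-covered on both sides, hence removed. Conversely, suppose
  \<open>y \<noteq> z\<close> satisfy \<open>y \<inter> x = z \<inter> x\<close>. Choose a hyperplane \<open>h\<close> of \<open>y\<close> containing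
  \<open>y \<inter> z\<close>. Then \<open>dim (h + x) < dim (z + x)\<close>, so some \<open>v \<in> z\<close> lies outside \<open>h + x\<close>, and
  \<open>w = h + \<langle>v\<rangle>\<close> is a neighbour of \<open>y\<close> closer to \<open>z\<close> with \<open>w \<inter> x = z \<inter> x\<close>. The
  components are therefore the nonempty fibres of the map, indexed by the subspaces of \<open>x\<close> of
  dimension \<open>D - i\<close>; these are counted by their ordered bases. The same exchange step with
  \<open>x = 0\<close> shows that the distance in the Grassmann graph is \<open>D - dim (y \<inter> z)\<close>.
\<close>

section \<open>Exchange steps between subspaces\<close>

context finite_dimensional_vector_space
begin

text \<open>\<open>dim\<close> depends only on the span, so \<open>S \<union> T\<close> can stand
  for the sum of \<open>S\<close> and \<open>T\<close> in the dimension formula.\<close>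

lemma dim_Un_Int:
  assumes "subspace S" "subspace T"
  shows "dim (S \<union> T) + dim (S \<inter> T) = dim S + dim T"
proof -
  have "span (S \<union> T) = {x + y |x y. x \<in> S \<and> y \<in> T}"
    using assms by (simp add: span_Un span_eq_iff[THEN iffD2])
  then show ?thesis
    using dim_sums_Int[OF assms] by (metis dim_span)
qed

text \<open>If \<open>k *s v\<close> plus an element of \<open>h\<close> lies in \<open>x\<close>
  with \<open>k\<close> nonzero, then dividing by \<open>k\<close> puts \<open>v\<close> into
  \<open>h + x\<close>. Hence a vector outside \<open>h + x\<close> can be adjoined to
  \<open>h\<close> without changing its trace on \<open>x\<close>.\<close>

lemma span_insert_Int_eq:
  assumes "subspace h" "subspace x" "v \<notin> span (h \<union> x)"
  shows "span (insert v h) \<inter> x = h \<inter> x"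
proof
  show "span (insert v h) \<inter> x \<subseteq> h \<inter> x"
  proof
    fix a assume a: "a \<in> span (insert v h) \<inter> x"
    then obtain k where "a - k *s v \<in> span h"
      by (auto simp: span_insert)
    then have k: "a - k *s v \<in> h"
      using assms(1) by (simp add: span_eq_iff[THEN iffD2])
    have "k = 0"
    proof (rule ccontr)
      assume "k \<noteq> 0"
      have "a - (a - k *s v) \<in> span (h \<union> x)"
        by (rule span_diff) (use a k in \<open>auto intro: span_base\<close>)
      then have "k *s v \<in> span (h \<union> x)"
        by simp
      then have "inverse k *s (k *s v) \<in> span (h \<union> x)"
        by (rule span_scale)
      with \<open>k \<noteq> 0\<close> assms(3) show False
        by simp
    qed
    with a k show "a \<in> h \<inter> x"
      by simp
  qed
  show "h \<inter> x \<subseteq> span (insert v h) \<inter> x"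
    by (auto intro: span_base)
qed

lemma exists_subspace_between:
  assumes "subspace u" "subspace y" "u \<subseteq> y" "dim u + k \<le> dim y"
  shows "\<exists>h. subspace h \<and> u \<subseteq> h \<and> h \<subseteq> y \<and> dim h = dim u + k"
  using assms(4)
proof (induction k)
  case 0
  then show ?case
    using assms by auto
next
  case (Suc k)
  then obtain h where h: "subspace h" "u \<subseteq> h" "h \<subseteq> y" "dim h = dim u + k"
    by auto
  have "\<not> y \<subseteq> h"
    using Suc.prems h(4) dim_subset[of y h] by auto
  then obtain v where v: "v \<in> y" "v \<notin> h"
    by auto
  have "span (insert v h) \<subseteq> y"
    using v h assms(2) by (intro span_minimal) auto
  moreover have "dim (span (insert v h)) = dim u + Suc k"
    using h v by (simp add: dim_insert span_eq_iff[THEN iffD2])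
  ultimately show ?case
    using h(2) by (intro exI[of _ "span (insert v h)"]) (auto intro: span_base)
qed

text \<open>Shows that no fibre is empty. Vectors are adjoined one at a time, each outside
  \<open>y + x\<close>; the dimension bound keeps \<open>y + x\<close> proper until \<open>k\<close>
  of them are chosen.\<close>

lemma exists_subspace_with_Int:
  assumes "subspace a" "subspace x" "a \<subseteq> x" "dim x + k \<le> dim UNIV"
  shows "\<exists>y. subspace y \<and> y \<inter> x = a \<and> dim y = dim a + k"
  using assms(4)
proof (induction k)
  case 0
  then show ?case
    using assms by auto
next
  case (Suc k)
  then obtain y where y: "subspace y" "y \<inter> x = a" "dim y = dim a + k"
    by auto
  have "dim (y \<union> x) = dim x + k"
    using dim_Un_Int[OF y(1) assms(2)] y by simp
  then have "span (y \<union> x) \<noteq> UNIV"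
    using Suc.prems by (metis Suc_n_not_le_n add_Suc_right dim_span)
  then obtain v where v: "v \<notin> span (y \<union> x)"
    by auto
  then have "v \<notin> span y"
    using span_mono[of y "y \<union> x"] by auto
  then have "dim (span (insert v y)) = dim a + Suc k"
    using y by (simp add: dim_insert)
  moreover have "span (insert v y) \<inter> x = a"
    using span_insert_Int_eq[OF y(1) assms(2) v] y by simp
  ultimately show ?case
    by (intro exI[of _ "span (insert v y)"]) simp
qed

text \<open>Taking \<open>v\<close> outside \<open>y\<close> keeps \<open>y \<inter> w\<close> down
  to \<open>h\<close>, while taking it in \<open>z\<close> makes the intersection with
  \<open>z\<close> strictly larger.\<close>

lemma exchange_step:
  assumes "subspace y" "subspace z" "subspace h" "y \<inter> z \<subseteq> h" "h \<subseteq> y"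
    and "Suc (dim h) = dim y" "v \<in> z" "v \<notin> y"
  defines "w \<equiv> span (insert v h)"
  shows "dim w = dim y" "y \<inter> w = h" "dim (y \<inter> z) < dim (w \<inter> z)"
proof -
  show "dim w = dim y"
    using assms by (auto simp: w_def dim_insert span_eq_iff[THEN iffD2])
  \<comment> \<open>With \<open>y\<close> in the role of \<open>x\<close>, the condition
    \<open>v \<notin> span (h \<union> x)\<close> reduces to \<open>v \<notin> y\<close>.\<close>
  have "span (h \<union> y) = y"
    using assms(1,5) by (simp add: Un_absorb1 span_eq_iff[THEN iffD2])
  then show "y \<inter> w = h"
    using span_insert_Int_eq[OF assms(3,1), of v] assms(5,8) by (auto simp: w_def)
  have "y \<inter> z \<subseteq> w \<inter> z"
    using assms(4) by (auto simp: w_def intro: span_base)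
  moreover have "v \<in> w \<inter> z"
    using assms(7) by (auto simp: w_def intro: span_base)
  moreover have "subspace (y \<inter> z)" "subspace (w \<inter> z)"
    using assms(1,2) by (auto simp: w_def intro: subspace_inter)
  ultimately show "dim (y \<inter> z) < dim (w \<inter> z)"
    using assms(8) by (intro dim_psubset) (auto simp: span_eq_iff[THEN iffD2])
qed

text \<open>The induction step for building walks: \<open>D - dim (y \<inter> z)\<close> drops while
  the trace on \<open>x\<close> is preserved.\<close>

lemma exists_exchange_avoiding:
  assumes "subspace x" "subspace y" "subspace z" "dim y = dim z" "y \<noteq> z" "y \<inter> x = z \<inter> x"
  shows "\<exists>w. subspace w \<and> dim w = dim y \<and> Suc (dim (y \<inter> w)) = dim y \<and>
    dim (y \<inter> z) < dim (w \<inter> z) \<and> w \<inter> x = z \<inter> x"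
proof -
  have yz: "subspace (y \<inter> z)"
    using assms by (intro subspace_inter)
  have "y \<inter> z \<noteq> y"
    using assms subspace_dim_equal[of y z] by auto
  then have "dim (y \<inter> z) < dim y"
    using assms(2) yz by (intro dim_psubset) (auto simp: span_eq_iff[THEN iffD2])
  then obtain h where h: "subspace h" "y \<inter> z \<subseteq> h" "h \<subseteq> y" "Suc (dim h) = dim y"
    using exists_subspace_between[OF yz assms(2), of "dim y - 1 - dim (y \<inter> z)"] by auto
  \<comment> \<open>The common trace of \<open>y\<close> and \<open>z\<close> on \<open>x\<close>
    lies in \<open>y \<inter> z\<close>, hence in \<open>h\<close>.\<close>
  have hx: "h \<inter> x = z \<inter> x"
    using h(2,3) assms(6) by auto
  \<comment> \<open>\<open>h\<close> and \<open>z\<close> have the same trace on \<open>x\<close>,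
    but \<open>h\<close> has one dimension less.\<close>
  have "dim (h \<union> x) < dim (z \<union> x)"
    using dim_Un_Int[OF h(1) assms(1)] dim_Un_Int[OF assms(3,1)] hx h(4) assms(4) by simp
  then have "\<not> z \<subseteq> span (h \<union> x)"
    by (metis Un_subset_iff dim_mono not_le span_superset)
  then obtain v where v: "v \<in> z" "v \<notin> span (h \<union> x)"
    by auto
  then have "v \<notin> y"
    using h(2) by (auto intro: span_base)
  then show ?thesis
    using exchange_step[OF assms(2,3) h v(1)] h(4) hx span_insert_Int_eq[OF h(1) assms(1) v(2)]
    by (intro exI[of _ "span (insert v h)"]) simp
qed

text \<open>Intersecting with \<open>x\<close> cannot raise codimension, since
  \<open>y \<inter> x\<close> and \<open>y \<inter> z\<close> span at most \<open>y\<close>. The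
  inequality in the premise also fits \<open>dim (y \<inter> z) = D - 1\<close> when
  \<open>D = 0\<close> and the subtraction is truncated.\<close>

lemma dim_Int_le_Suc:
  assumes "subspace x" "subspace y" "subspace z" "dim y \<le> Suc (dim (y \<inter> z))"
  shows "dim (y \<inter> x) \<le> Suc (dim (y \<inter> z \<inter> x))"
proof -
  have "dim ((y \<inter> x) \<union> (y \<inter> z)) \<le> dim y"
    by (intro dim_subset) auto
  moreover have "(y \<inter> x) \<inter> (y \<inter> z) = y \<inter> z \<inter> x"
    by auto
  ultimately show ?thesis
    using dim_Un_Int[of "y \<inter> x" "y \<inter> z"] assms by (simp add: subspace_inter)
qed

end

section \<open>Counting subspaces over a finite field\<close>

text \<open>Each new basis vector \<open>a\<close> multiplies the size by that of the field, because
  \<open>(k, w) \<mapsto> k *s a + w\<close> is a bijection from pairs onto the larger span.\<close>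

lemma (in vector_space) card_span_independent:
  assumes "finite B" "independent B" and fin: "finite (UNIV :: 'a set)"
  shows "card (span B) = card (UNIV :: 'a set) ^ card B"
  using assms(1,2)
proof (induction B rule: finite_induct)
  case empty
  then show ?case by simp
next
  case (insert a B)
  then have B: "independent B" "a \<notin> span B"
    by (auto simp: independent_insert)
  let ?f = "\<lambda>(k, w). k *s a + w"
  have "inj_on ?f (UNIV \<times> span B)"
  proof (rule inj_onI, clarsimp)
    fix k l w u assume *: "w \<in> span B" "u \<in> span B" "k *s a + w = l *s a + u"
    then have "(k - l) *s a = u - w"
      by (simp add: algebra_simps)
    then have "(k - l) *s a \<in> span B"
      using * by (simp add: span_diff)
    then have "inverse (k - l) *s ((k - l) *s a) \<in> span B"
      by (rule span_scale)
    then have "k = l"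
      using B(2) by (cases "k = l") auto
    with * show "k = l \<and> w = u" by simp
  qed
  moreover have "?f ` (UNIV \<times> span B) = span (insert a B)"
  proof (intro equalityI subsetI)
    fix v assume "v \<in> span (insert a B)"
    then obtain k where "v - k *s a \<in> span B"
      by (auto simp: span_insert)
    then show "v \<in> ?f ` (UNIV \<times> span B)"
      by (intro image_eqI[of _ _ "(k, v - k *s a)"]) auto
  next
    fix v assume "v \<in> ?f ` (UNIV \<times> span B)"
    then obtain k w where "v = k *s a + w" "w \<in> span B"
      by auto
    then show "v \<in> span (insert a B)"
      by (auto simp: span_insert intro!: exI[of _ k])
  qed
  ultimately have "card (span (insert a B)) = card ((UNIV :: 'a set) \<times> span B)"
    by (metis card_image)
  then show ?case
    using insert B by (simp add: card_cartesian_product)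
qed

text \<open>Ordered lists make the choices multiply: each new entry is any vector of
  \<open>S\<close> outside the span of those already chosen.\<close>

definition (in vector_space) indep_lists :: "'b set \<Rightarrow> nat \<Rightarrow> 'b list set" where
  "indep_lists S k = {xs. length xs = k \<and> distinct xs \<and> independent (set xs) \<and> set xs \<subseteq> S}"

definition (in vector_space) subspaces_of_dim :: "'b set \<Rightarrow> nat \<Rightarrow> 'b set set" where
  "subspaces_of_dim S k = {U. subspace U \<and> U \<subseteq> S \<and> dim U = k}"

locale finite_field_vector_space = finite_dimensional_vector_space scale Basis
  for scale :: "'a::{field,finite} \<Rightarrow> 'b::ab_group_add \<Rightarrow> 'b" (infixr \<open>*s\<close> 75) and Basis
begin

lemma card_subspace:
  assumes "subspace S"
  shows "card S = card (UNIV :: 'a set) ^ dim S"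
proof -
  obtain B where "B \<subseteq> S" "independent B" "S \<subseteq> span B" "card B = dim S"
    using basis_exists by metis
  then show ?thesis
    using card_span_independent[of B] span_subspace[of B S] assms
    by (simp add: finiteI_independent)
qed

lemma finite_vector_set: "finite (S :: 'b set)"
proof -
  \<comment> \<open>An infinite set has \<open>card\<close> 0 by default, so a positive power of the
    field size proves finiteness.\<close>
  have "card (UNIV :: 'b set) > 0"
    by (subst card_subspace) (auto simp: finite_UNIV_card_ge_0)
  then show ?thesis
    using finite_subset[of S UNIV] card_ge_0_finite by blast
qed

lemma span_indep_list:
  assumes "subspace S" "xs \<in> indep_lists S k"
  shows "span (set xs) \<subseteq> S" "dim (span (set xs)) = k"
  using assms
  by (auto simp: indep_lists_def dim_span_eq_card_independent distinct_card simp del: dim_span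
        dest: span_minimal[of _ S])

lemma indep_lists_Suc:
  "indep_lists S (Suc k) = (\<lambda>(xs, v). v # xs) ` (SIGMA xs:indep_lists S k. S - span (set xs))"
proof (intro equalityI subsetI)
  fix ys assume ys: "ys \<in> indep_lists S (Suc k)"
  then obtain v xs where "ys = v # xs"
    by (cases ys) (auto simp: indep_lists_def)
  with ys show "ys \<in> (\<lambda>(xs, v). v # xs) ` (SIGMA xs:indep_lists S k. S - span (set xs))"
    by (auto simp: indep_lists_def independent_insert intro!: image_eqI[of _ _ "(xs, v)"])
next
  fix ys assume "ys \<in> (\<lambda>(xs, v). v # xs) ` (SIGMA xs:indep_lists S k. S - span (set xs))"
  then obtain v xs where "ys = v # xs" "xs \<in> indep_lists S k" "v \<in> S" "v \<notin> span (set xs)"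
    by auto
  then show "ys \<in> indep_lists S (Suc k)"
    using independent_insertI[of v "set xs"] span_base[of v "set xs"] by (auto simp: indep_lists_def)
qed

text \<open>A list of length \<open>k\<close> spans \<open>q^k\<close> vectors, which are the ones
  excluded at the next choice. For \<open>k > dim S\<close> both sides vanish, the right one through
  the factor \<open>j = dim S\<close>.\<close>

lemma card_indep_lists:
  assumes "subspace S"
  shows "card (indep_lists S k) = (\<Prod>j<k. card (UNIV :: 'a set) ^ dim S - card (UNIV :: 'a set) ^ j)"
proof (induction k)
  case 0
  have "indep_lists S 0 = {[]}"
    by (auto simp: indep_lists_def independent_empty)
  then show ?case by simp
next
  case (Suc k)
  let ?q = "card (UNIV :: 'a set)"
  have fin: "finite (indep_lists S k)"
    by (rule finite_subset[OF _ finite_lists_length_eq[OF finite_vector_set[of S], of k]])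
       (auto simp: indep_lists_def)
  have "card (S - span (set xs)) = ?q ^ dim S - ?q ^ k" if "xs \<in> indep_lists S k" for xs
    using span_indep_list[OF assms that] assms finite_vector_set
    by (simp add: card_Diff_subset card_subspace del: dim_span)
  then have "card (SIGMA xs:indep_lists S k. S - span (set xs))
      = card (indep_lists S k) * (?q ^ dim S - ?q ^ k)"
    using fin finite_vector_set by simp
  moreover have "inj_on (\<lambda>(xs, v). v # xs) (SIGMA xs:indep_lists S k. S - span (set xs))"
    by (auto simp: inj_on_def)
  ultimately show ?case
    using Suc by (simp add: indep_lists_Suc card_image)
qed

text \<open>Double counting: the independent lists of length \<open>k\<close> in \<open>S\<close>
  are grouped by their span, and each \<open>k\<close>-dimensional subspace has the same number of
  ordered bases.\<close>

lemma card_subspaces_of_dim: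
  fixes S :: "'b set" and k :: nat
  defines "q \<equiv> card (UNIV :: 'a set)"
  assumes "subspace S"
  shows "card (subspaces_of_dim S k) * (\<Prod>j<k. q ^ k - q ^ j) = (\<Prod>j<k. q ^ dim S - q ^ j)"
proof -
  \<comment> \<open>The list determines \<open>U\<close>, which makes the union below
    disjoint.\<close>
  have span_eq: "span (set xs) = U" if "U \<in> subspaces_of_dim S k" "xs \<in> indep_lists U k" for xs U
    using that span_indep_list[of U xs k] subspace_dim_equal[of "span (set xs)" U]
    by (auto simp: subspaces_of_dim_def)
  have "indep_lists S k = (\<Union>U\<in>subspaces_of_dim S k. indep_lists U k)"
  proof (intro equalityI subsetI)
    fix xs assume xs: "xs \<in> indep_lists S k"
    then have "span (set xs) \<in> subspaces_of_dim S k"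
      using span_indep_list[OF assms(2) xs] by (auto simp: subspaces_of_dim_def)
    moreover have "xs \<in> indep_lists (span (set xs)) k"
      using xs by (auto simp: indep_lists_def span_base)
    ultimately show "xs \<in> (\<Union>U\<in>subspaces_of_dim S k. indep_lists U k)"
      by blast
  qed (auto simp: subspaces_of_dim_def indep_lists_def)
  also have "card \<dots> = (\<Sum>U\<in>subspaces_of_dim S k. card (indep_lists U k))"
  proof (rule card_UN_disjoint)
    show "finite (subspaces_of_dim S k)"
      using finite_vector_set[of S] by (auto simp: subspaces_of_dim_def intro: finite_subset[of _ "Pow S"])
    show "\<forall>U\<in>subspaces_of_dim S k. finite (indep_lists U k)"
    proof
      fix U show "finite (indep_lists U k)"
        by (rule finite_subset[OF _ finite_lists_length_eq[OF finite_vector_set[of U], of k]])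
           (auto simp: indep_lists_def)
    qed
    show "\<forall>U\<in>subspaces_of_dim S k. \<forall>W\<in>subspaces_of_dim S k.
        U \<noteq> W \<longrightarrow> indep_lists U k \<inter> indep_lists W k = {}"
      using span_eq by blast
  qed
  also have "\<dots> = card (subspaces_of_dim S k) * (\<Prod>j<k. q ^ k - q ^ j)"
    by (simp add: subspaces_of_dim_def card_indep_lists q_def)
  finally show ?thesis
    using card_indep_lists[OF assms(2), of k] by (simp add: q_def)
qed

end

section \<open>Arithmetic of Gaussian binomial coefficients\<close>

lemma prod_q_int_mult:
  assumes "n \<le> l"
  shows "(\<Prod>k<n. q_int q (l - k)) * (\<Prod>k<l - n. q_int q (l - n - k)) = (\<Prod>k<l. q_int q (l - k))"
proof -
  have "(\<Prod>k<l - n. q_int q (l - n - k)) = (\<Prod>k=n..<l. q_int q (l - k))"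
    using prod.shift_bounds_nat_ivl[of "\<lambda>k. q_int q (l - k)" 0 n "l - n"] assms
    by (simp add: lessThan_atLeast0 add.commute)
  then show ?thesis
    using prod.atLeastLessThan_concat[of 0 n l "\<lambda>k. q_int q (l - k)"] assms
    by (simp add: lessThan_atLeast0)
qed

lemma prod_q_int_nonzero:
  assumes "q \<ge> 2"
  shows "(\<Prod>k<n. q_int q (n - k)) \<noteq> 0"
proof -
  have "q_int q m \<noteq> 0" if "m > 0" for m
  proof -
    have "(1 :: rat) < of_nat q ^ m"
      using assms that by (intro one_less_power) auto
    with assms show ?thesis
      by (simp add: q_int_def)
  qed
  then show ?thesis by simp
qed

text \<open>After cross-multiplication both sides are the \<open>q\<close>-factorial of
  \<open>l\<close>. This passes from counting subspaces of dimension \<open>D - i\<close> to the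
  coefficient with lower index \<open>i\<close>.\<close>

lemma q_binomial_symmetric:
  assumes "q \<ge> 2" "n \<le> l"
  shows "q_binomial q l (l - n) = q_binomial q l n"
proof -
  have "(\<Prod>k<l - n. q_int q (l - k)) * (\<Prod>k<n. q_int q (n - k))
      = (\<Prod>k<n. q_int q (l - k)) * (\<Prod>k<l - n. q_int q (l - n - k))"
    using prod_q_int_mult[of n l q] prod_q_int_mult[of "l - n" l q] assms by simp
  then show ?thesis
    using prod_q_int_nonzero[OF assms(1)] by (simp add: q_binomial_def frac_eq_eq mult.commute)
qed

text \<open>Factor by factor, \<open>q^n - q^j\<close> is \<open>q^j (q - 1) [n - j]\<close>. The
  part without \<open>[n - j]\<close> is independent of \<open>n\<close>, so it cancels in the
  quotient of two such products.\<close>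

lemma prod_power_diff:
  assumes "q \<ge> 2" "k \<le> n"
  shows "of_nat (\<Prod>j<k. q ^ n - q ^ j) = (\<Prod>j<k. of_nat q ^ j * (of_nat q - 1)) * (\<Prod>j<k. q_int q (n - j))"
proof -
  have "of_nat (q ^ n - q ^ j) = of_nat q ^ j * (of_nat q - 1) * q_int q (n - j)" if "j < k" for j
  proof -
    \<comment> \<open>Makes the truncated subtraction exact before passing to the rationals.\<close>
    have "q ^ j \<le> q ^ n"
      using assms that by (intro power_increasing) auto
    then have "of_nat (q ^ n - q ^ j) = (of_nat q ^ n - of_nat q ^ j :: rat)"
      by simp
    also have "\<dots> = of_nat q ^ j * (of_nat q ^ (n - j) - 1)"
      using assms that by (simp add: right_diff_distrib flip: power_add)
    finally show ?thesis
      using assms by (simp add: q_int_def)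
  qed
  then show ?thesis
    by (simp add: prod.distrib[symmetric] of_nat_prod cong: prod.cong_simp del: of_nat_diff)
qed

context finite_field_vector_space
begin

lemma card_subspaces_eq_q_binomial:
  assumes "subspace S" "k \<le> dim S"
  shows "of_nat (card (subspaces_of_dim S k)) = q_binomial (card (UNIV :: 'a set)) (dim S) k"
proof -
  let ?q = "card (UNIV :: 'a set)"
  have q: "?q \<ge> 2"
    using card_mono[of UNIV "{0, 1 :: 'a}"] by simp
  let ?P = "\<Prod>j<k. of_nat ?q ^ j * (of_nat ?q - 1 :: rat)"
  have "of_nat (card (subspaces_of_dim S k)) * of_nat (\<Prod>j<k. ?q ^ k - ?q ^ j)
      = (of_nat (\<Prod>j<k. ?q ^ dim S - ?q ^ j) :: rat)"
    by (metis card_subspaces_of_dim[OF assms(1)] of_nat_mult)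
  then have "?P * (of_nat (card (subspaces_of_dim S k)) * (\<Prod>j<k. q_int ?q (k - j)))
      = ?P * (\<Prod>j<k. q_int ?q (dim S - j))"
    unfolding prod_power_diff[OF q order_refl] prod_power_diff[OF q assms(2)]
    by (simp only: mult_ac)
  moreover have "?P \<noteq> 0"
    using q by simp
  ultimately have "of_nat (card (subspaces_of_dim S k)) * (\<Prod>j<k. q_int ?q (k - j))
      = (\<Prod>j<k. q_int ?q (dim S - j))"
    by (metis mult_left_cancel)
  then show ?thesis
    using prod_q_int_nonzero[OF q, of k] by (simp add: q_binomial_def eq_divide_eq)
qed

end

section \<open>Components as fibres of a map\<close>

text \<open>Connectedness means reachability along arcs in either direction, and equality of values
  is symmetric.\<close>

lemma connected_const:
  assumes "Digraph_Component.connected H" "\<And>u v. (u, v) \<in> arcs_ends H \<Longrightarrow> f u = f v"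
    and "u \<in> verts H" "v \<in> verts H"
  shows "f u = f v"
proof -
  have "(u, v) \<in> rtrancl_on (verts H) (symcl (arcs_ends H))"
    using assms by (auto simp: connected_conv)
  then show ?thesis
    by (induction rule: rtrancl_on_induct) (use assms(2) in \<open>auto simp: symcl_def\<close>)
qed

text \<open>By \<open>arc\<close> a connected subgraph lies in one fibre, and by
  \<open>reach\<close> every nonempty fibre induces a connected subgraph, which is therefore
  maximal.\<close>

lemma (in sym_digraph) components_eq_fibres:
  fixes f :: "'a \<Rightarrow> 'c"
  assumes arc: "\<And>u v. u \<rightarrow> v \<Longrightarrow> f u = f v"
    and reach: "\<And>u v. u \<in> verts G \<Longrightarrow> v \<in> verts G \<Longrightarrow> f u = f v \<Longrightarrow> u \<rightarrow>\<^sup>* v"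
  shows "components G = (\<lambda>c. G \<restriction> {v \<in> verts G. f v = c}) ` f ` verts G"
proof -
  define F where "F c = {v \<in> verts G. f v = c}" for c
  have sub: "subgraph (G \<restriction> F c) G" for c
    by (intro induced_imp_subgraph induced_induce) (auto simp: F_def)
  have inF: "subgraph H (G \<restriction> F (f u))" 
    if H: "subgraph H G" "Digraph_Component.connected H" and u: "u \<in> verts H" for H u
  proof -
    have "f v = f u" if "v \<in> verts H" for v
      using H(2) _ that u
      by (rule connected_const) (use arc arcs_ends_mono[OF H(1)] in auto)
    then have "verts H \<subseteq> F (f u)"
      using subgraph_imp_subverts[OF H(1)] by (auto simp: F_def)
    then show ?thesis
      using H(1) by (auto simp: subgraph_def compatible_def wf_digraph.wellformed)
  qed
  \<comment> \<open>In this form, the fibre is a set to which restriction preserves paths.\<close>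
  have eq_reach: "F (f u) = {v. u \<rightarrow>\<^sup>* v}" if "u \<in> verts G" for u
  proof -
    have "f v = f u" if "u \<rightarrow>\<^sup>* v" for v
      using that by (induction rule: reachable_induct) (metis arc)+
    then show ?thesis
      using reach[of u] that unfolding F_def by (metis (no_types, lifting) reachable_in_verts(2))
  qed
  have conn: "Digraph_Component.connected (G \<restriction> F (f u))" if "u \<in> verts G" for u
  proof -
    interpret F: wf_digraph "G \<restriction> F (f u)"
      by (rule wellformed_induce_subgraph)
    show ?thesis
    proof (rule F.connectedI)
      show "verts (G \<restriction> F (f u)) \<noteq> {}"
        using that by (auto simp: F_def)
      fix v w assume "v \<in> verts (G \<restriction> F (f u))" "w \<in> verts (G \<restriction> F (f u))"
      then have vw: "v \<in> verts G" "w \<in> verts G" "f v = f u" "f w = f u"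
        by (auto simp: F_def)
      then have "v \<rightarrow>\<^sup>*\<^bsub>G \<restriction> F (f v)\<^esub> w"
        using reach eq_reach[of v] induce_reachable_preserves_paths[of v w] by simp
      then show "v \<rightarrow>\<^sup>*\<^bsub>mk_symmetric (G \<restriction> F (f u))\<^esub> w"
        using vw by (intro F.reachable_mk_symmetricI) simp
    qed
  qed
  \<comment> \<open>Compatibility also equates the \<open>tail\<close> and \<open>head\<close>
    functions, so the records agree in every field.\<close>
  have antisym: "H = K" if "subgraph H K" "subgraph K H" for H K :: "('a, 'b) pre_digraph"
    using that by (auto simp: subgraph_def compatible_def)
  have "components G = (\<lambda>c. G \<restriction> F c) ` f ` verts G"
  proof (intro equalityI subsetI)
    fix H assume "H \<in> components G"
    then have H: "subgraph H G" "Digraph_Component.connected H"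
      and max: "\<And>K. K \<noteq> H \<Longrightarrow> subgraph H K \<Longrightarrow> subgraph K G \<Longrightarrow> \<not> Digraph_Component.connected K"
      by (auto simp: components_def max_subgraph_def)
    obtain u where u: "u \<in> verts H"
      using H(2) by (auto simp: connected_conv)
    then have "u \<in> verts G"
      using subgraph_imp_subverts[OF H(1)] by auto
    with max[OF _ inF[OF H u] sub] conn have "G \<restriction> F (f u) = H"
      by blast
    with \<open>u \<in> verts G\<close> show "H \<in> (\<lambda>c. G \<restriction> F c) ` f ` verts G"
      by auto
  next
    fix H assume "H \<in> (\<lambda>c. G \<restriction> F c) ` f ` verts G"
    then obtain u where u: "u \<in> verts G" "H = G \<restriction> F (f u)"
      by auto
    have "K = H" if "subgraph H K" "subgraph K G" "Digraph_Component.connected K" for K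
    proof -
      have "u \<in> verts K"
        using subgraph_imp_subverts[OF that(1)] u by (auto simp: F_def)
      from inF[OF that(2,3) this] u(2) that(1) show ?thesis
        by (intro antisym) auto
    qed
    then show "H \<in> components G"
      using sub conn[OF u(1)] u(2) by (auto simp: components_def max_subgraph_def)
  qed
  then show ?thesis
    by (simp add: F_def)
qed

lemma (in sym_digraph) card_components_fibres:
  fixes f :: "'a \<Rightarrow> 'c"
  assumes "\<And>u v. u \<rightarrow> v \<Longrightarrow> f u = f v"
    and "\<And>u v. u \<in> verts G \<Longrightarrow> v \<in> verts G \<Longrightarrow> f u = f v \<Longrightarrow> u \<rightarrow>\<^sup>* v"
  shows "card (components G) = card (f ` verts G)"
proof -
  \<comment> \<open>A nonempty fibre determines its value, and an induced subgraph determines its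
    vertex set.\<close>
  have "inj_on (\<lambda>c. G \<restriction> {v \<in> verts G. f v = c}) (f ` verts G)"
  proof (rule inj_onI)
    fix c d assume "c \<in> f ` verts G"
      and eq: "G \<restriction> {v \<in> verts G. f v = c} = G \<restriction> {v \<in> verts G. f v = d}"
    moreover have "{v \<in> verts G. f v = c} = {v \<in> verts G. f v = d}"
      using arg_cong[OF eq, of verts] by simp
    ultimately show "c = d" by auto
  qed
  moreover have "components G = (\<lambda>c. G \<restriction> {v \<in> verts G. f v = c}) ` f ` verts G"
    using assms by (rule components_eq_fibres)
  ultimately show ?thesis
    by (simp add: card_image)
qed

section \<open>Grassmann graphs\<close>

context finite_dimensional_vector_space
begin

section \<open>Distance and spheres in the Grassmann graph\<close>

lemma grassmann_graph_simps [simp]: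
  "verts (grassmann_graph scale D) = grassmann_vertices scale D"
  "arcs (grassmann_graph scale D) = {(y, z). y \<in> grassmann_vertices scale D \<and>
     z \<in> grassmann_vertices scale D \<and> dim (y \<inter> z) = D - 1}"
  "tail (grassmann_graph scale D) = fst"
  "head (grassmann_graph scale D) = snd"
  by (auto simp: grassmann_graph_def)

text \<open>Each arc lowers the dimension of the intersection with \<open>x\<close> by at most one.
  The subspace \<open>x\<close> stays fixed while the start varies in the induction; the distance
  bound takes the initial vertex for \<open>x\<close>.\<close>

lemma grassmann_walk_lower_bound:
  assumes "subspace x" "pre_digraph.awalk (grassmann_graph scale D) y p z"
  shows "dim (y \<inter> x) \<le> dim (z \<inter> x) + length p"
proof -
  interpret wf_digraph "grassmann_graph scale D"
    using sym_digraph_grassmann_graph by (rule sym_digraph.axioms)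
  show ?thesis
    using assms(2)
  proof (induction p arbitrary: y)
    case Nil
    then show ?case by (simp add: awalk_Nil_iff)
  next
    case (Cons e p)
    then obtain w where e: "(y, w) \<in> arcs (grassmann_graph scale D)" and "awalk w p z"
      by (cases e) (auto simp: awalk_Cons_iff)
    then have "dim (w \<inter> x) \<le> dim (z \<inter> x) + length p"
      using Cons.IH by blast
    moreover have "dim (y \<inter> x) \<le> Suc (dim (y \<inter> w \<inter> x))"
      using e by (intro dim_Int_le_Suc assms(1)) (auto simp: grassmann_vertices_def)
    moreover have "dim (y \<inter> w \<inter> x) \<le> dim (w \<inter> x)"
      by (rule dim_subset) auto
    ultimately show ?case by simp
  qed
qed

lemma grassmann_walk_exists:
  assumes "y \<in> grassmann_vertices scale D" "z \<in> grassmann_vertices scale D"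
  shows "\<exists>p. pre_digraph.awalk (grassmann_graph scale D) y p z \<and> length p \<le> D - dim (y \<inter> z)"
proof -
  interpret wf_digraph "grassmann_graph scale D"
    using sym_digraph_grassmann_graph by (rule sym_digraph.axioms)
  show ?thesis
    using assms(1)
  proof (induction "D - dim (y \<inter> z)" arbitrary: y rule: less_induct)
    case less
    show ?case
    proof (cases "y = z")
      case True
      then show ?thesis
        using less.prems by (intro exI[of _ "[]"]) (simp add: awalk_Nil_iff)
    next
      case False
      have yz: "subspace y" "subspace z" "dim y = D" "dim z = D"
        using less.prems assms(2) by (auto simp: grassmann_vertices_def)
      \<comment> \<open>With \<open>{0}\<close> as the subspace to avoid, the trace condition of the
        exchange holds automatically.\<close>
      then have "y \<inter> {0} = z \<inter> {0}"
        by (auto intro: subspace_0)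
      then obtain w where w: "subspace w" "dim w = D" "Suc (dim (y \<inter> w)) = D"
        "dim (y \<inter> z) < dim (w \<inter> z)"
        using exists_exchange_avoiding[of "{0}" y z] yz False by auto
      have "dim (w \<inter> z) \<le> D"
        using dim_subset[of "w \<inter> z" z] yz by simp
      moreover have wG: "w \<in> grassmann_vertices scale D"
        using w by (simp add: grassmann_vertices_def)
      moreover have "D - dim (w \<inter> z) < D - dim (y \<inter> z)"
        using \<open>dim (w \<inter> z) \<le> D\<close> w(4) by linarith
      ultimately obtain p where p: "awalk w p z" "length p \<le> D - dim (w \<inter> z)"
        using less.hyps[of w] by blast
      have "(y, w) \<in> arcs (grassmann_graph scale D)"
        using less.prems wG w(3) by auto
      with p w(4) \<open>dim (w \<inter> z) \<le> D\<close> show ?thesis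
        by (intro exI[of _ "(y, w) # p"]) (auto simp: awalk_Cons_iff)
    qed
  qed
qed

lemma path_length_dist_grassmann:
  assumes "y \<in> grassmann_vertices scale D" "z \<in> grassmann_vertices scale D"
  shows "path_length_dist (grassmann_graph scale D) y z = ereal (real (D - dim (y \<inter> z)))"
proof -
  interpret wf_digraph "grassmann_graph scale D"
    using sym_digraph_grassmann_graph by (rule sym_digraph.axioms)
  have cost: "awalk_cost (\<lambda>_. 1) p = real (length p)" for p
    by (induction p) auto
  have z: "subspace z" "dim z = D"
    using assms by (auto simp: grassmann_vertices_def)
  have lower: "D - dim (y \<inter> z) \<le> length p" if "awalk y p z" for p
    using grassmann_walk_lower_bound[of y D y p z] that assms
    by (auto simp: grassmann_vertices_def Int_commute)
  obtain p where p: "awalk y p z" "length p \<le> D - dim (y \<inter> z)"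
    using grassmann_walk_exists[OF assms] by auto
  show ?thesis
    unfolding path_length_dist_def \<mu>_def cost
  proof (rule antisym)
    show "(INF p\<in>{p. awalk y p z}. ereal (real (length p))) \<le> ereal (real (D - dim (y \<inter> z)))"
      using p by (intro INF_lower2[of p]) auto
    show "ereal (real (D - dim (y \<inter> z))) \<le> (INF p\<in>{p. awalk y p z}. ereal (real (length p)))"
      using lower by (intro INF_greatest) simp
  qed
qed

lemma sphere_grassmann:
  assumes "x \<in> grassmann_vertices scale D" "i \<le> D"
  shows "sphere (grassmann_graph scale D) x i =
    {y \<in> grassmann_vertices scale D. dim (y \<inter> x) = D - i}"
proof -
  have "path_length_dist (grassmann_graph scale D) x y = ereal (real i) \<longleftrightarrow> dim (y \<inter> x) = D - i"
    if y: "y \<in> grassmann_vertices scale D" for y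
  proof -
    have "dim (y \<inter> x) \<le> dim x"
      by (intro dim_subset) auto
    \<comment> \<open>Together with \<open>i \<le> D\<close>, this makes
      \<open>D - dim (y \<inter> x) = i\<close> equivalent to
      \<open>dim (y \<inter> x) = D - i\<close> despite truncation.\<close>
    then have "dim (y \<inter> x) \<le> D"
      using assms(1) by (simp add: grassmann_vertices_def)
    then show ?thesis
      using path_length_dist_grassmann[OF assms(1) y] assms(2) by (auto simp: Int_commute)
  qed
  then show ?thesis
    by (auto simp: sphere_def)
qed

section \<open>Vertices, arcs and reachability in the graph \<gamma>\<close>

lemma gamma_graph_ends [simp]:
  "tail (gamma_graph scale D x i) = fst" "head (gamma_graph scale D x i) = snd"
  by (simp_all add: gamma_graph_def Let_def)

lemma verts_gamma_graph:
  assumes "x \<in> grassmann_vertices scale D" "i \<le> D"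
  shows "verts (gamma_graph scale D x i) = {y \<in> grassmann_vertices scale D. dim (y \<inter> x) = D - i}"
  using sphere_grassmann[OF assms] by (simp add: gamma_graph_def Let_def)

text \<open>For adjacent \<open>y\<close>, \<open>z\<close> in the sphere,
  \<open>y \<inter> z \<inter> x\<close> has dimension \<open>D - i\<close> or one less. In the
  first case it equals both traces on \<open>x\<close>; in the second both covers are slash covers
  and the edge is removed.\<close>

lemma arcs_gamma_graph:
  assumes "D \<ge> 1" "x \<in> grassmann_vertices scale D" "i \<le> D"
  shows "arcs (gamma_graph scale D x i) = {(y, z).
    y \<in> verts (gamma_graph scale D x i) \<and> z \<in> verts (gamma_graph scale D x i) \<and>
    dim (y \<inter> z) = D - 1 \<and> y \<inter> x = z \<inter> x}"
proof -
  have x: "subspace x"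
    using assms by (simp add: grassmann_vertices_def)
  have slash_iff: "slash_covers scale x y (y \<inter> z) \<and> slash_covers scale x z (y \<inter> z) \<longleftrightarrow> y \<inter> x \<noteq> z \<inter> x"
    if y: "y \<in> grassmann_vertices scale D" "dim (y \<inter> x) = D - i"
      and z: "z \<in> grassmann_vertices scale D" "dim (z \<inter> x) = D - i"
      and yz: "dim (y \<inter> z) = D - 1" for y z
  proof -
    have sub: "subspace y" "subspace z" "dim y = D" "dim z = D"
      using y z by (auto simp: grassmann_vertices_def)
    then have subs: "subspace (y \<inter> z)" "subspace (y \<inter> x)" "subspace (z \<inter> x)"
        "subspace (y \<inter> z \<inter> x)"
      using x by (auto intro: subspace_inter)
    \<comment> \<open>As \<open>D \<ge> 1\<close>, \<open>D - 1\<close> is one below the dimension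
      of \<open>y\<close> and \<open>z\<close>, so only the condition on traces remains, and it is
      the same for both.\<close>
    have slash: "slash_covers scale x y (y \<inter> z) \<longleftrightarrow> dim (y \<inter> z \<inter> x) + 1 = D - i"
      "slash_covers scale x z (y \<inter> z) \<longleftrightarrow> dim (y \<inter> z \<inter> x) + 1 = D - i"
      using sub subs y z yz assms(1) by (auto simp: slash_covers_def)
    have le: "D - i \<le> Suc (dim (y \<inter> z \<inter> x))"
      using dim_Int_le_Suc[OF x sub(1,2)] sub y yz by auto
    show ?thesis
    proof (cases "y \<inter> x = z \<inter> x")
      case True
      then have "y \<inter> z \<inter> x = y \<inter> x"
        by auto
      with True y(2) show ?thesis
        by (simp add: slash)
    next
      case False
      have "dim (y \<inter> z \<inter> x) \<noteq> D - i"
      proof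
        assume eq: "dim (y \<inter> z \<inter> x) = D - i"
        have "y \<inter> z \<inter> x = y \<inter> x"
          using eq y(2) subs by (intro subspace_dim_equal) auto
        moreover have "y \<inter> z \<inter> x = z \<inter> x"
          using eq z(2) subs by (intro subspace_dim_equal) auto
        ultimately show False
          using False by simp
      qed
      moreover have "dim (y \<inter> z \<inter> x) \<le> dim (y \<inter> x)"
        by (intro dim_subset) auto
      ultimately show ?thesis
        using False le y(2) by (simp add: slash)
    qed
  qed
  have arcs: "arcs (gamma_graph scale D x i) = {(y, z).
      (y \<in> grassmann_vertices scale D \<and> dim (y \<inter> x) = D - i) \<and>
      (z \<in> grassmann_vertices scale D \<and> dim (z \<inter> x) = D - i) \<and> dim (y \<inter> z) = D - 1 \<and>
      \<not> (slash_covers scale x y (y \<inter> z) \<and> slash_covers scale x z (y \<inter> z))}"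
    unfolding gamma_graph_def Let_def sphere_grassmann[OF assms(2,3)] by auto
  show ?thesis
  proof (rule set_eqI)
    fix e :: "'b set \<times> 'b set"
    obtain y z where "e = (y, z)"
      by (cases e)
    then show "e \<in> arcs (gamma_graph scale D x i) \<longleftrightarrow> e \<in> {(y, z).
        y \<in> verts (gamma_graph scale D x i) \<and> z \<in> verts (gamma_graph scale D x i) \<and>
        dim (y \<inter> z) = D - 1 \<and> y \<inter> x = z \<inter> x}"
      unfolding verts_gamma_graph[OF assms(2,3)] arcs
      using slash_iff[of y z] by (simp only: mem_Collect_eq prod.case) blast
  qed
qed

lemma gamma_graph_dominates_iff:
  assumes "D \<ge> 1" "x \<in> grassmann_vertices scale D" "i \<le> D"
  shows "y \<rightarrow>\<^bsub>gamma_graph scale D x i\<^esub> z \<longleftrightarrow>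
    y \<in> verts (gamma_graph scale D x i) \<and> z \<in> verts (gamma_graph scale D x i) \<and>
    dim (y \<inter> z) = D - 1 \<and> y \<inter> x = z \<inter> x"
  by (simp add: arcs_ends_conv arcs_gamma_graph[OF assms] image_iff)

text \<open>Exchanges that fix the trace on \<open>x\<close> stay in the sphere and use only edges
  that were kept.\<close>

lemma gamma_graph_reachable:
  assumes "D \<ge> 1" "x \<in> grassmann_vertices scale D" "i \<le> D"
    and "y \<in> verts (gamma_graph scale D x i)" "z \<in> verts (gamma_graph scale D x i)"
    and "y \<inter> x = z \<inter> x"
  shows "y \<rightarrow>\<^sup>*\<^bsub>gamma_graph scale D x i\<^esub> z"
proof -
  interpret sym_digraph "gamma_graph scale D x i"
    by (rule sym_digraph_gamma_graph)
  show ?thesis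
    using assms(4,6)
  proof (induction "D - dim (y \<inter> z)" arbitrary: y rule: less_induct)
    case less
    show ?case
    proof (cases "y = z")
      case True
      then show ?thesis
        using less.prems by simp
    next
      case False
      have yz: "subspace x" "subspace y" "subspace z" "dim y = D" "dim z = D" "dim (z \<inter> x) = D - i"
        using less.prems assms by (auto simp: verts_gamma_graph grassmann_vertices_def)
      then obtain w where w: "subspace w" "dim w = D" "Suc (dim (y \<inter> w)) = D"
        "dim (y \<inter> z) < dim (w \<inter> z)" "w \<inter> x = z \<inter> x"
        using exists_exchange_avoiding[of x y z] less.prems False by auto
      have "dim (w \<inter> z) \<le> D"
        using dim_subset[of "w \<inter> z" z] yz by simp
      moreover have wG: "w \<in> verts (gamma_graph scale D x i)"
        using w yz assms by (simp add: verts_gamma_graph grassmann_vertices_def)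
      moreover have "D - dim (w \<inter> z) < D - dim (y \<inter> z)"
        using \<open>dim (w \<inter> z) \<le> D\<close> w(4) by linarith
      ultimately have "w \<rightarrow>\<^sup>*\<^bsub>gamma_graph scale D x i\<^esub> z"
        using less.hyps[of w] w(5) by blast
      moreover have "y \<rightarrow>\<^bsub>gamma_graph scale D x i\<^esub> w"
        using gamma_graph_dominates_iff[OF assms(1-3)] less.prems wG w(3,5) by auto
      ultimately show ?thesis
        by (rule adj_reachable_trans[rotated])
    qed
  qed
qed

text \<open>Identifies the index set of the components. Since \<open>dim x + i \<le> 2 * D\<close>,
  there is room to extend any subspace of \<open>x\<close> of dimension \<open>D - i\<close> by
  \<open>i\<close> dimensions away from \<open>x\<close>.\<close>

lemma Int_image_verts_gamma_graph:
  assumes "x \<in> grassmann_vertices scale D" "i \<le> D" "2 * D \<le> dim UNIV"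
  shows "(\<lambda>y. y \<inter> x) ` verts (gamma_graph scale D x i) = subspaces_of_dim x (D - i)"
proof (intro equalityI subsetI)
  fix a assume "a \<in> (\<lambda>y. y \<inter> x) ` verts (gamma_graph scale D x i)"
  then show "a \<in> subspaces_of_dim x (D - i)"
    using assms by (auto simp: verts_gamma_graph subspaces_of_dim_def grassmann_vertices_def
        intro: subspace_inter)
next
  fix a assume "a \<in> subspaces_of_dim x (D - i)"
  moreover from this obtain y where "subspace y" "y \<inter> x = a" "dim y = dim a + i"
    using exists_subspace_with_Int[of a x i] assms
    by (auto simp: subspaces_of_dim_def grassmann_vertices_def)
  ultimately show "a \<in> (\<lambda>y. y \<inter> x) ` verts (gamma_graph scale D x i)"
    using assms by (auto simp: verts_gamma_graph subspaces_of_dim_def grassmann_vertices_def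
        intro!: image_eqI[of _ _ y])
qed

end

theorem lemma7p5:
  fixes scale :: "'a::{field,finite} \<Rightarrow> 'b::ab_group_add \<Rightarrow> 'b"
    and q N D i :: nat
    and x :: "'b set"
  assumes "vector_space scale"
    and "card (UNIV :: 'a set) = q"
    and "vector_space.dim scale UNIV = N"
    and "D \<ge> 1"
    and "N > 2 * D"
    and "x \<in> grassmann_vertices scale D"
    and "i \<le> D"
  shows "of_nat (card (components (gamma_graph scale D x i))) = q_binomial q D i
    \<and> (\<forall>H \<in> components (gamma_graph scale D x i).
         \<exists>\<alpha>. module.subspace scale \<alpha> \<and> \<alpha> \<subseteq> x \<and> vector_space.dim scale \<alpha> = D - i \<and>
             H = gamma_graph scale D x i \<restriction> G_set scale D x \<alpha>)"
proof -
  interpret vector_space scale by fact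
  obtain B where B: "independent B" "span B = UNIV" "card B = N"
    using basis_exists[of UNIV] assms(3) by (metis top.extremum_uniqueI)
  \<comment> \<open>\<open>N > 2 * D\<close> makes \<open>card B\<close> positive, which an infinite
    basis would not allow.\<close>
  then have "finite B"
    using assms(5) by (intro card_ge_0_finite) simp
  with B interpret finite_field_vector_space scale B
    by unfold_locales
  interpret gamma: sym_digraph "gamma_graph scale D x i"
    by (rule sym_digraph_gamma_graph)
  let ?G = "gamma_graph scale D x i"
  have x: "subspace x" "dim x = D"
    using assms(6) by (auto simp: grassmann_vertices_def)
  have q: "q \<ge> 2"
    using card_mono[of UNIV "{0, 1 :: 'a}"] assms(2) by simp
  have arc: "y \<inter> x = z \<inter> x" if "y \<rightarrow>\<^bsub>?G\<^esub> z" for y z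
    using that gamma_graph_dominates_iff assms by blast
  have reach: "y \<rightarrow>\<^sup>*\<^bsub>?G\<^esub> z" if "y \<in> verts ?G" "z \<in> verts ?G" "y \<inter> x = z \<inter> x" for y z
    using that assms by (intro gamma_graph_reachable)
  have img: "(\<lambda>y. y \<inter> x) ` verts ?G = subspaces_of_dim x (D - i)"
    using assms by (intro Int_image_verts_gamma_graph) auto
  have "card (components ?G) = card (subspaces_of_dim x (D - i))"
    unfolding img[symmetric] using arc reach by (rule gamma.card_components_fibres)
  then have "of_nat (card (components ?G)) = q_binomial q D i"
    using card_subspaces_eq_q_binomial[OF x(1), of "D - i"] q_binomial_symmetric[OF q assms(7)]
      x(2) assms(2) by simp
  moreover have "components ?G = (\<lambda>a. ?G \<restriction> {y \<in> verts ?G. y \<inter> x = a}) ` (\<lambda>y. y \<inter> x) ` verts ?G"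
    using arc reach by (rule gamma.components_eq_fibres)
  \<comment> \<open>For \<open>a\<close> of dimension \<open>D - i\<close>, every vertex with trace
    \<open>a\<close> lies in the sphere, so the fibre over \<open>a\<close> is all of
    \<open>G_set scale D x a\<close>.\<close>
  then have "components ?G = (\<lambda>a. ?G \<restriction> G_set scale D x a) ` subspaces_of_dim x (D - i)"
    unfolding img
    using assms(6,7) by (auto simp: verts_gamma_graph G_set_def subspaces_of_dim_def
        intro!: image_cong arg_cong[of _ _ "induce_subgraph ?G"])
  ultimately show ?thesis
    by (auto simp: subspaces_of_dim_def)
qed

end
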